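(* Let $\mathcal{A}$ be an alphabet of size $n\geq2$ and let $l$ be a positive integer. Then $$\varepsilon(n,l)=\begin{cases} n^{l/2}\,\pi_n(l)+\displaystyle\sum_{d\in \Lambda^-(l)} \pi_n\!\left(\frac{3l}{d}\right) & \text{if } l \text{ is even},\\[2mm] \displaystyle\sum_{d\in \Lambda(l)} \pi_n\!\left(\frac{3l}{d}\right) & \text{if } l \text{ is odd}.\end{cases}$$
   Context: A nonempty word $u$ is primitive if $u=v^m$ with $m$ a positive integer implies $m=1$; $|u|$ is the length of $u$. $\pi_n(k)$ denotes the number of primitive words of length $k$ over an alphabet of size $n$. $\Lambda(l)=\{d\ :\ d\mid l,\ d\not\equiv 0 \pmod 3,\ d\geq 4\}$ and $\Lambda^-(l)$ is the set of odd elements of $\Lambda(l)$. $\varepsilon(n,l)$ is the number of pairs $(p,q)$ of primitive words over $\mathcal{A}$ with $|p|=2|q|=2l$ and $pq$ not primitive. *)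

theory Defs
  imports Main
begin

text \<open>Words are lists; \<^term>\<open>lists A\<close> is the set of words over the alphabet \<open>A\<close>, and the
  power \<open>v\<^sup>m\<close> is \<^term>\<open>concat (replicate m v)\<close>.\<close>

definition primitive :: "'a list \<Rightarrow> bool" where
  "primitive u \<longleftrightarrow> u \<noteq> [] \<and> (\<forall>v m. 0 < m \<and> u = concat (replicate m v) \<longrightarrow> m = 1)"

definition primitive_words :: "'a set \<Rightarrow> nat \<Rightarrow> 'a list set" where
  "primitive_words A k = {u \<in> lists A. length u = k \<and> primitive u}"

text \<open>The number \<open>\<pi>\<^sub>n(k)\<close> depends on the alphabet only through its size, so it is
  defined using the representative alphabet \<^term>\<open>{..<n}\<close>.\<close>

definition num_primitive :: "nat \<Rightarrow> nat \<Rightarrow> nat" where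
  "num_primitive n k = card (primitive_words {..<n} k)"

definition Lambda :: "nat \<Rightarrow> nat set" where
  "Lambda l = {d. d dvd l \<and> d mod 3 \<noteq> 0 \<and> 4 \<le> d}"

definition Lambda_odd :: "nat \<Rightarrow> nat set" where
  "Lambda_odd l = {d \<in> Lambda l. odd d}"

text \<open>This is \<open>\<epsilon>(n,l)\<close>, with the alphabet \<open>A\<close> of size \<open>n\<close> made explicit.\<close>

definition epsilon :: "'a set \<Rightarrow> nat \<Rightarrow> nat" where
  "epsilon A l = card {(p, q). p \<in> lists A \<and> q \<in> lists A \<and> primitive p \<and> primitive q \<and>
     length p = 2 * length q \<and> 2 * length q = 2 * l \<and> \<not> primitive (p @ q)}"

end

theory Submission
  imports Defs
begin

text \<open>A non-primitive \<open>pq\<close> is \<open>t\<^sup>d\<close> with \<open>t\<close> primitive, \<open>d \<ge> 2\<close> and \<open>d|t| = 3l\<close>. If \<open>3\<close>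
  divides \<open>d\<close>, then \<open>p\<close> is itself a proper power of \<open>t\<close>. If not, then \<open>d\<close> divides \<open>l\<close>. For
  \<open>d \<ge> 4\<close>, Fine and Wilf's theorem shows that both factors are automatically primitive, so that
  \<open>d\<close> contributes one pair for each \<open>t\<close>. For \<open>d = 2\<close> put \<open>l = 2m\<close> and \<open>t = xu\<close> with
  \<open>|x| = m\<close>, so that \<open>p = xux\<close> and \<open>q = u\<close>; again \<open>p\<close> is primitive as soon as \<open>u\<close> is. There are
  \<open>n\<^sup>m \<pi>\<^sub>n(l)\<close> pairs \<open>(x, u)\<close> with \<open>u\<close> primitive, and those with \<open>xu\<close> not primitive are the
  powers \<open>s\<^sup>e\<close> of length \<open>3m\<close> with \<open>s\<close> primitive, \<open>e | m\<close>, \<open>e \<ge> 2\<close>, \<open>3\<close> not dividing \<open>e\<close>. They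
  cancel exactly the contributions of the even \<open>d = 2e\<close> in \<open>\<Lambda>(l)\<close>.\<close>

subsection \<open>Periods and the theorem of Fine and Wilf\<close>

abbreviation pow :: "'a list \<Rightarrow> nat \<Rightarrow> 'a list" where
  "pow v m \<equiv> concat (replicate m v)"

text \<open>Every function has the junk period \<open>0\<close>, because \<open>i mod 0 = i\<close>.\<close>
definition periodic :: "(nat \<Rightarrow> 'a) \<Rightarrow> nat \<Rightarrow> nat \<Rightarrow> bool" where
  "periodic f n a \<longleftrightarrow> (\<forall>i<n. f i = f (i mod a))"

text \<open>The shift form allows one period to be subtracted from another, as in
  \<open>fine_wilf\<close>. The residue form is the convenient one for moving a period between a
  word and its factors.\<close>

lemma periodic_iff_shift: "periodic f n a \<longleftrightarrow> (\<forall>i. i + a < n \<longrightarrow> f (i + a) = f i)"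
proof
  assume p: "periodic f n a"
  show "\<forall>i. i + a < n \<longrightarrow> f (i + a) = f i"
  proof (intro allI impI)
    fix i assume "i + a < n"
    then have "f (i + a) = f ((i + a) mod a)" "f i = f (i mod a)"
      using p unfolding periodic_def by auto
    then show "f (i + a) = f i" by simp
  qed
next
  assume s: "\<forall>i. i + a < n \<longrightarrow> f (i + a) = f i"
  have "f i = f (i mod a)" if "i < n" for i
    using that
  proof (induction i rule: less_induct)
    case (less i)
    show ?case
    proof (cases "a = 0 \<or> i < a")
      case False
      then have "f (i - a) = f ((i - a) mod a)" using less by simp
      moreover have "f i = f (i - a)" using s less.prems False
        by (metis le_add_diff_inverse2 not_less)
      ultimately show ?thesis using False by (simp add: mod_if)
    qed auto
  qed
  then show "periodic f n a" unfolding periodic_def by blast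
qed

lemma periodic_mono: "periodic f n a \<Longrightarrow> k \<le> n \<Longrightarrow> periodic f k a"
  by (simp add: periodic_def)

text \<open>Reducing an index mod \<open>a\<close> lands it in the first \<open>k\<close> positions,
  where \<open>g\<close> is already a period. Since \<open>g\<close> divides \<open>a\<close>, the
  residue mod \<open>g\<close> is unchanged.\<close>

lemma periodic_extend:
  assumes "periodic f n a" "periodic f k g" "0 < a" "a \<le> k" "g dvd a"
  shows "periodic f n g"
  unfolding periodic_def
proof (intro allI impI)
  fix i assume "i < n"
  then have "f i = f (i mod a)" using assms(1) by (simp add: periodic_def)
  moreover have "i mod a < k" using assms(3,4) by (meson less_le_trans mod_less_divisor)
  then have "f (i mod a) = f (i mod a mod g)" using assms(2) by (simp add: periodic_def)
  ultimately show "f i = f (i mod g)" by (simp add: mod_mod_cancel assms(5))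
qed

text \<open>Subtractive Euclidean algorithm: for periods c < d, the first n - c positions also have
  period d - c, because f (i + d - c) = f (i + d) = f i. The induction hypothesis gives the gcd on
  this prefix, and period c carries it to the rest. The gcd stands on the right of the bound to
  avoid truncated subtraction.\<close>

theorem fine_wilf:
  assumes "0 < a" "0 < b" "periodic f n a" "periodic f n b" "a + b \<le> n + gcd a b"
  shows "periodic f n (gcd a b)"
  using assms
proof (induction "a + b" arbitrary: a b n rule: less_induct)
  case less
  have step: "periodic f n (gcd c d)"
    if h: "c < d" "0 < c" "periodic f n c" "periodic f n d" "c + d \<le> n + gcd c d"
      "c + d = a + b" for c d
  proof -
    have g: "gcd c (d - c) = gcd c d"
      using h(1) by (metis gcd.commute gcd_diff1_nat less_imp_le)
    \<comment> \<open>With the length bound this gives 2c \<le> n, so the shortened prefix still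
      contains a full period \<open>c\<close>, as \<open>periodic_extend\<close> requires.\<close>
    have le: "gcd c d \<le> d - c"
      by (metis g gcd_le2_nat h(1) zero_less_diff less_not_refl)
    have "periodic f (n - c) (gcd c (d - c))"
    proof (rule less.hyps)
      show "periodic f (n - c) c" using h(3) by (rule periodic_mono) simp
      show "periodic f (n - c) (d - c)"
        unfolding periodic_iff_shift
      proof (intro allI impI)
        fix i assume i: "i + (d - c) < n - c"
        then have "f (i + d) = f i" using h(1,4) by (simp add: periodic_iff_shift)
        moreover have "f (i + (d - c) + c) = f (i + (d - c))"
          using h(3) i by (auto simp: periodic_iff_shift)
        ultimately show "f (i + (d - c)) = f i" using h(1) by simp
      qed
    qed (use h g in auto)
    then show ?thesis
      using periodic_extend[OF h(3), of "n - c"] h le g by simp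
  qed
  consider "a < b" | "b < a" | "a = b" by linarith
  then show ?case
  proof cases
    case 1 then show ?thesis using step less.prems by simp
  next
    case 2 then show ?thesis using step[of b a] less.prems by (simp add: gcd.commute add.commute)
  next
    case 3 then show ?thesis using less.prems by simp
  qed
qed

subsection \<open>Primitive words and primitive roots\<close>

lemma length_pow [simp]: "length (pow v m) = m * length v"
  by (induction m) auto

lemma nth_pow: "i < m * length v \<Longrightarrow> pow v m ! i = v ! (i mod length v)"
proof (induction m arbitrary: i)
  case (Suc m)
  show ?case
  proof (cases "i < length v")
    case False
    then show ?thesis using Suc by (simp add: nth_append mod_if[of i])
  qed (simp add: nth_append)
qed simp

lemma pow_add: "pow v (a + b) = pow v a @ pow v b"
  by (simp add: replicate_add)

lemma pow_eq_iff:
  assumes "0 < m"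
  shows "u = pow v m \<longleftrightarrow> length u = m * length v \<and> v = take (length v) u
    \<and> periodic ((!) u) (length u) (length v)"
proof
  assume u: "u = pow v m"
  obtain k where "m = Suc k" using assms gr0_implies_Suc by blast
  then have "v = take (length v) u" using u by simp
  moreover have "periodic ((!) u) (length u) (length v)"
    unfolding periodic_def
  proof (intro allI impI)
    fix i assume "i < length u"
    then have "i < m * length v" "i mod length v < m * length v"
      using u by (auto intro: le_less_trans[OF mod_less_eq_dividend])
    then show "u ! i = u ! (i mod length v)" by (simp add: u nth_pow)
  qed
  ultimately show "length u = m * length v \<and> v = take (length v) u
    \<and> periodic ((!) u) (length u) (length v)" using u by simp
next
  assume h: "length u = m * length v \<and> v = take (length v) u
    \<and> periodic ((!) u) (length u) (length v)"
  show "u = pow v m"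
  proof (rule nth_equalityI)
    fix i assume i: "i < length u"
    then have "0 < length v" using h by (cases "length v") auto
    then have "i mod length v < length v" by simp
    then have "u ! (i mod length v) = v ! (i mod length v)" using h by (metis nth_take)
    then show "u ! i = pow v m ! i" using h i by (simp add: nth_pow periodic_def)
  qed (use h in simp)
qed

text \<open>Turns primitivity into a statement about periods, to which \<open>fine_wilf\<close>
  applies. The junk period \<open>0\<close> does no harm, since it divides the length of the empty
  word only.\<close>

lemma primitive_iff_periodic:
  "primitive u \<longleftrightarrow> u \<noteq> [] \<and>
    (\<forall>g. g dvd length u \<and> periodic ((!) u) (length u) g \<longrightarrow> g = length u)"
proof (cases "u = []")
  case False
  show ?thesis
  proof
    assume p: "primitive u"
    have "g = length u" if g: "g dvd length u" "periodic ((!) u) (length u) g" for g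
    proof -
      obtain m where m: "length u = m * g" using g(1) by (metis dvd_def mult.commute)
      have "0 < m" using m False by (cases m) auto
      have lg: "length (take g u) = g" using m \<open>0 < m\<close> by simp
      then have "u = pow (take g u) m"
        using pow_eq_iff[OF \<open>0 < m\<close>, of u "take g u"] m g(2) by simp
      then have "m = 1" using p \<open>0 < m\<close> unfolding primitive_def by blast
      then show ?thesis using m by simp
    qed
    then show "u \<noteq> [] \<and> (\<forall>g. g dvd length u \<and> periodic ((!) u) (length u) g \<longrightarrow> g = length u)"
      using False by blast
  next
    assume h: "u \<noteq> [] \<and> (\<forall>g. g dvd length u \<and> periodic ((!) u) (length u) g \<longrightarrow> g = length u)"
    have "m = 1" if m: "0 < m" "u = pow v m" for v m
    proof -
      have "length u = m * length v" "periodic ((!) u) (length u) (length v)"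
        using m pow_eq_iff by blast+
      then show ?thesis using h by (metis dvd_triv_right length_0_conv mult_cancel2 mult_1)
    qed
    then show "primitive u" using False unfolding primitive_def by blast
  qed
qed (simp add: primitive_def)

lemma primitive_periodicD:
  "primitive u \<Longrightarrow> g dvd length u \<Longrightarrow> periodic ((!) u) (length u) g \<Longrightarrow> g = length u"
  by (simp add: primitive_iff_periodic)

lemma not_primitive_pow: "m \<noteq> 1 \<Longrightarrow> \<not> primitive (pow v m)"
  by (cases "m = 0") (auto simp: primitive_def)

lemma primitive_root_exists:
  "u \<noteq> [] \<Longrightarrow> \<exists>t m. 0 < m \<and> primitive t \<and> u = pow t m"
proof (induction "length u" arbitrary: u rule: less_induct)
  case less
  show ?case
  proof (cases "primitive u")
    case True
    then have "0 < (1::nat) \<and> primitive u \<and> u = pow u 1" by simp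
    then show ?thesis by blast
  next
    case False
    then obtain v m where m: "0 < m" "u = pow v m" "m \<noteq> 1"
      using less.prems unfolding primitive_def by blast
    then have "v \<noteq> []" using less.prems by auto
    moreover have "length v < length u" using m \<open>v \<noteq> []\<close> by simp
    ultimately obtain t k where t: "0 < k" "primitive t" "v = pow t k"
      using less.hyps by blast
    have "pow (pow t k) j = pow t (j * k)" for j
      by (induction j) (simp_all add: pow_add)
    then have "u = pow t (m * k)" using m t by simp
    then show ?thesis using t m by (metis nat_0_less_mult_iff)
  qed
qed

text \<open>The common power has both lengths as periods, hence also their gcd. This period passes
  to the prefixes \<open>s\<close> and \<open>t\<close>, and their primitivity makes both lengths
  equal to the gcd.\<close>

lemma primitive_root_unique:
  assumes "primitive s" "primitive t" "0 < a" "0 < b" "pow s a = pow t b"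
  shows "s = t \<and> a = b"
proof -
  define w where "w = pow s a"
  have s: "length w = a * length s" "s = take (length s) w" "periodic ((!) w) (length w) (length s)"
    using pow_eq_iff[OF assms(3), of w s] w_def by auto
  have t: "length w = b * length t" "t = take (length t) w" "periodic ((!) w) (length w) (length t)"
    using pow_eq_iff[OF assms(4), of w t] w_def assms(5) by auto
  have pos: "0 < length s" "0 < length t" using assms(1,2) by (auto simp: primitive_def)
  let ?g = "gcd (length s) (length t)"
  \<comment> \<open>If one exponent is 1, one length divides the other and the bound holds with
    equality; otherwise each length is at most half of the whole.\<close>
  have "length s + length t \<le> length w + ?g"
  proof (cases "a = 1 \<or> b = 1")
    case True
    then show ?thesis
    proof
      assume "a = 1"
      then have "length t dvd length s" using s(1) t(1) \<open>a = 1\<close> by (metis dvd_triv_right mult_1)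
      then show ?thesis using s(1) \<open>a = 1\<close> by (simp add: gcd_nat.absorb2)
    next
      assume "b = 1"
      then have "length s dvd length t" using s(1) t(1) \<open>b = 1\<close> by (metis dvd_triv_right mult_1)
      then show ?thesis using t(1) \<open>b = 1\<close> by (simp add: gcd_nat.absorb1)
    qed
  next
    case False
    then have "2 \<le> a" "2 \<le> b" using assms(3,4) by auto
    then have "2 * length s \<le> length w" "2 * length t \<le> length w"
      unfolding s(1) by (simp, simp only: s(1)[symmetric] t(1) mult_le_mono1)
    then show ?thesis by simp
  qed
  then have g: "periodic ((!) w) (length w) ?g" using fine_wilf pos s(3) t(3) by blast
  have "?g = length v" if "primitive v" "v = take (length v) w" "length v \<le> length w"
    "?g dvd length v" for v
  proof -
    have "periodic ((!) v) (length v) ?g"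
      unfolding periodic_def
    proof (intro allI impI)
      fix i assume i: "i < length v"
      then have "i mod ?g < length v" by (meson le_less_trans mod_less_eq_dividend)
      moreover have "w ! i = w ! (i mod ?g)" using g i that(3) by (simp add: periodic_def)
      ultimately show "v ! i = v ! (i mod ?g)" using i that(2) by (metis nth_take)
    qed
    then show ?thesis using primitive_periodicD that by blast
  qed
  moreover have "length s \<le> length w" using s(1) assms(3) by simp
  moreover have "length t \<le> length w" using t(1) assms(4) by simp
  ultimately have "?g = length s" "?g = length t" using assms(1,2) s(2) t(2) by auto
  then have l: "length s = length t" by simp
  then have "s = t" using s(2) t(2) by simp
  moreover have "a = b" using s(1) t(1) l pos by simp
  ultimately show ?thesis by blast
qed

text \<open>A period that divides the length is a cyclic period, so it survives rotation. A period
  of the rotated word is brought back to \<open>u\<close> by rotating further.\<close>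

lemma primitive_rotate:
  assumes "primitive u"
  shows "primitive (rotate k u)"
proof -
  have rot: "periodic ((!) (rotate j v)) (length v) g"
    if v: "g dvd length v" "periodic ((!) v) (length v) g" for j g and v :: "'a list"
    unfolding periodic_def
  proof (intro allI impI)
    fix i assume i: "i < length v"
    then have lt: "x mod length v < length v" for x by (auto intro: mod_less_divisor)
    have *: "v ! (x mod length v) = v ! (x mod g)" for x
      using v lt[of x] by (simp add: periodic_def mod_mod_cancel)
    have "i mod g < length v" using i by (meson le_less_trans mod_less_eq_dividend)
    then show "rotate j v ! i = rotate j v ! (i mod g)"
      using i by (simp add: nth_rotate * mod_simps)
  qed
  \<comment> \<open>Chosen so that \<open>j + k\<close> is a multiple of the length, whence
    \<open>rotate j\<close> undoes \<open>rotate k\<close>.\<close>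
  define j where "j = length u - k mod length u"
  have "0 < length u" using assms by (simp add: primitive_def)
  then have "j + k = length u + k div length u * length u"
    unfolding j_def by (metis add.assoc add.commute div_mult_mod_eq le_add_diff_inverse2
        less_imp_le mod_less_divisor)
  then have "(j + k) mod length u = 0" by simp
  then have "rotate j (rotate k u) = u" by (simp add: rotate_rotate rotate_id)
  then show ?thesis
    using assms rot[of _ "rotate k u" j] unfolding primitive_iff_periodic
    by (metis length_rotate rotate_is_Nil_conv)
qed

section \<open>Primitivity of long factors of a power\<close>

lemma three_mult_eq_four_mult: "3 * g = 4 * j \<Longrightarrow> \<exists>i. j = 3 * i \<and> g = 4 * (i::nat)"
  by presburger

lemma two_mult_eq_five_mult: "2 * g = 5 * j \<Longrightarrow> \<exists>i. j = 2 * i \<and> g = 5 * (i::nat)"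
  by presburger

lemma coprime_3:
  assumes "\<not> 3 dvd c"
  shows "coprime 3 (c::nat)"
proof -
  have "gcd 3 c \<le> 3" by (simp add: dvd_imp_le)
  moreover have "gcd 3 c \<noteq> 0" by simp
  moreover have "gcd 3 c \<noteq> 2" using gcd_dvd1[of 3 c] by (intro notI) simp
  moreover have "gcd 3 c \<noteq> 3" using assms by (metis gcd_dvd2)
  ultimately have "gcd 3 c = 1" by linarith
  then show ?thesis by (simp add: coprime_iff_gcd_eq_1)
qed

text \<open>The bound \<open>4 \<le> c\<close> is what Fine and Wilf's theorem needs: for \<open>c \<ge> 6\<close> two periods fit
  into \<open>f\<close> without overlap, while for \<open>c = 4\<close> and \<open>c = 5\<close> the length can be attained with equality.\<close>
lemma third_period_primitive:
  assumes t: "primitive t" and f: "\<And>i. i < length f \<Longrightarrow> f ! i = t ! (i mod length t)"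
    and len: "3 * length f = c * length t" and c: "\<not> 3 dvd c" "4 \<le> c"
  shows "primitive f"
proof -
  have pos: "0 < length t" using t by (simp add: primitive_def)
  have "4 * length t \<le> 3 * length f" using len c(2) by simp
  then have tf: "length t \<le> length f" by simp
  have "3 dvd c * length t" by (metis len dvd_triv_left)
  moreover have "coprime 3 c" using c(1) by (rule coprime_3)
  ultimately have "3 dvd length t" by (simp add: coprime_dvd_mult_right_iff)
  then obtain j where j: "length t = 3 * j" by blast
  have lf: "length f = c * j" using len j by simp
  have "g = length f" if g: "g dvd length f" "periodic ((!) f) (length f) g" for g
  proof (rule ccontr)
    assume ne: "g \<noteq> length f"
    obtain k where k: "length f = k * g" using g(1) by (metis dvd_def mult.commute)
    then have gp: "0 < g" using tf pos by (cases g) auto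
    have "k \<noteq> 0" "k \<noteq> 1" using k ne tf pos by (metis mult_0 le_zero_eq less_irrefl, simp)
    then have k2: "2 \<le> k" by simp
    let ?d = "gcd g (length t)"
    have kg: "k * g = c * j" using k lf by simp
    have *: "i \<le> ?d" if "i dvd g" "i dvd length t" for i
      using dvd_imp_le[OF gcd_greatest[OF that]] pos by simp
    \<comment> \<open>Here |t| = 3j and |f| = cj = kg. The gcd is needed only for (c, k) = (4, 2),
      (4, 3) and (5, 2), where the common divisors j, i and i supply exactly the missing
      length.\<close>
    have "g + length t \<le> length f + ?d"
    proof -
      consider "6 \<le> c" | "c = 4" | "c = 5" using c(2) by linarith
      then show ?thesis
      proof cases
        case 1
        have "2 * g \<le> k * g" "6 * j \<le> c * j" using k2 1 by simp_all
        then show ?thesis using kg lf j by linarith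
      next
        case 2
        consider "k = 2" | "k = 3" | "4 \<le> k" using k2 by linarith
        then show ?thesis
        proof cases
          case 1
          then show ?thesis using kg lf j 2 *[of j] by simp
        next
          case 2
          then have "3 * g = 4 * j" using kg \<open>c = 4\<close> by simp
          then obtain i where "j = 3 * i" "g = 4 * i" using three_mult_eq_four_mult by blast
          then show ?thesis using lf j \<open>c = 4\<close> *[of i] by simp
        next
          case 3
          then have "4 * g \<le> k * g" by simp
          then have "g \<le> j" using kg 2 by simp
          then show ?thesis using lf j 2 by simp
        qed
      next
        case 3
        consider "k = 2" | "3 \<le> k" using k2 by linarith
        then show ?thesis
        proof cases
          case 1
          then have "2 * g = 5 * j" using kg 3 by simp
          then obtain i where "j = 2 * i" "g = 5 * i" using two_mult_eq_five_mult by blast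
          then show ?thesis using lf j 3 *[of i] by simp
        next
          case 2
          then have "3 * g \<le> k * g" by simp
          then have "3 * g \<le> 5 * j" using kg 3 by simp
          then show ?thesis using lf j 3 by simp
        qed
      qed
    qed
    moreover have "periodic ((!) f) (length f) (length t)"
    proof -
      have "i mod length t < length f" for i using pos tf by (meson less_le_trans mod_less_divisor)
      then show ?thesis by (simp add: periodic_def f)
    qed
    ultimately have "periodic ((!) f) (length f) ?d" using fine_wilf gp pos g(2) by blast
    then have "periodic ((!) t) (length t) ?d"
    proof -
      have ft: "f ! i = t ! i" if "i < length t" for i using f[of i] that tf by simp
      have "i mod ?d < length t" if "i < length t" for i
        using that by (meson le_less_trans mod_less_eq_dividend)
      then show ?thesis
        using \<open>periodic ((!) f) (length f) ?d\<close> tf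
        unfolding periodic_def by (metis ft less_le_trans)
    qed
    \<comment> \<open>Now |t| divides g and hence |f|, so 3|f| = c|t| would make c a multiple of
      3.\<close>
    then have "?d = length t" using primitive_periodicD t by blast
    then have "length t dvd length f" using g(1) by (metis dvd_trans gcd_dvd1)
    then obtain q where "length f = q * length t" by (metis dvd_def mult.commute)
    then have "c = 3 * q" using len pos by simp
    then show False using c(1) by simp
  qed
  then show ?thesis using tf pos unfolding primitive_iff_periodic by auto
qed

text \<open>The word is a conjugate of xxu, whose prefix xx has period |x|. If xxu had a proper
  divisor g of its length as a period, Fine and Wilf on xx would give the period gcd(|x|, g), and g
  would spread it over the whole word. Then u would have a period dividing its length and at most
  half of it.\<close>

lemma primitive_conj_double:
  assumes u: "primitive u" and len: "length u = 2 * length x"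
  shows "primitive (x @ u @ x)"
proof -
  let ?m = "length x" and ?w = "x @ x @ u"
  have pos: "0 < ?m" using u len by (cases x) (auto simp: primitive_def)
  have "g = length ?w" if g: "g dvd length ?w" "periodic ((!) ?w) (length ?w) g" for g
  proof (rule ccontr)
    assume ne: "g \<noteq> length ?w"
    have lw: "length ?w = 4 * ?m" using len by simp
    obtain k where "length ?w = k * g" using g(1) by (metis dvd_def mult.commute)
    then have kg: "k * g = 4 * ?m" using lw by simp
    then have gp: "0 < g" using pos by (cases g) auto
    have "k \<noteq> 0" using kg pos by (metis mult_0 mult_eq_0_iff less_irrefl zero_neq_numeral)
    moreover have "k \<noteq> 1" using kg ne lw by auto
    ultimately have k2: "2 \<le> k" by simp
    let ?d = "gcd ?m g"
    have *: "i \<le> ?d" if "i dvd ?m" "i dvd g" for i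
      using dvd_imp_le[OF gcd_greatest[OF that]] pos by simp
    \<comment> \<open>The first inequality lets xx contain a full period \<open>g\<close>; the
      second is the Fine-Wilf bound on xx, attained for k = 2 and k = 3.\<close>
    have bound: "g \<le> 2 * ?m \<and> ?m + g \<le> 2 * ?m + ?d"
    proof -
      consider "k = 2" | "k = 3" | "4 \<le> k" using k2 by linarith
      then show ?thesis
      proof cases
        case 1
        then show ?thesis using kg *[of ?m] by simp
      next
        case 2
        then have "3 * g = 4 * ?m" using kg by simp
        then obtain i where "?m = 3 * i" "g = 4 * i" using three_mult_eq_four_mult by blast
        then show ?thesis using *[of i] by simp
      next
        case 3
        then have "4 * g \<le> k * g" by simp
        then show ?thesis using kg by linarith
      qed
    qed
    have "periodic ((!) ?w) (2 * ?m) ?m"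
      unfolding periodic_iff_shift by (auto simp: nth_append)
    moreover have "periodic ((!) ?w) (2 * ?m) g"
      using g(2) by (rule periodic_mono) (simp add: len)
    ultimately have "periodic ((!) ?w) (2 * ?m) ?d"
      using fine_wilf pos gp bound by blast
    then have p: "periodic ((!) ?w) (4 * ?m) ?d"
      using periodic_extend[OF g(2), of "2 * ?m" ?d] gp bound lw by simp
    have "periodic ((!) u) (length u) ?d"
      unfolding periodic_iff_shift
    proof (intro allI impI)
      fix i assume i: "i + ?d < length u"
      then have "?w ! (2 * ?m + i + ?d) = ?w ! (2 * ?m + i)"
        using p len unfolding periodic_iff_shift by simp
      moreover have "?w ! (2 * ?m + j) = u ! j" for j by (simp add: nth_append)
      ultimately show "u ! (i + ?d) = u ! i" by (metis add.assoc)
    qed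
    moreover have "?d dvd length u" using len by simp
    ultimately have "?d = length u" using primitive_periodicD u by blast
    moreover have "?d \<le> ?m" using pos by (simp add: gcd_le1_nat)
    ultimately show False using len pos by simp
  qed
  then have "primitive ?w" using pos unfolding primitive_iff_periodic by auto
  then have "primitive (rotate ?m ?w)" by (rule primitive_rotate)
  then show ?thesis by (simp add: rotate_append)
qed

text \<open>Read from position \<open>a\<close>, a power of \<open>t\<close> looks like a power of
  the conjugate \<open>rotate a t\<close>, which is again primitive.\<close>

lemma primitive_factor_pow:
  assumes t: "primitive t" and w: "take k (drop a (pow t d)) = f"
    and "3 * length f = c * length t" "\<not> 3 dvd c" "4 \<le> c"
  shows "primitive f"
proof (rule third_period_primitive)
  show "primitive (rotate a t)" using t by (rule primitive_rotate)
  fix i assume i: "i < length f"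
  then have "a + i < d * length t" and "f ! i = pow t d ! (a + i)"
    using w by auto
  then have "f ! i = t ! ((a + i) mod length t)" by (simp add: nth_pow)
  then show "f ! i = rotate a t ! (i mod length (rotate a t))"
    using t by (simp add: nth_rotate primitive_def mod_simps)
qed (use assms in simp_all)

text \<open>Two thirds of the power satisfy the length equation with c = 2d, which is at least 4
  already for d = 2. The last third has c = d, hence the extra condition there.\<close>

lemma primitive_thirds_pow:
  assumes t: "primitive t" and len: "3 * M = d * length t" and d: "\<not> 3 dvd d" "2 \<le> d"
  shows "primitive (take (2 * M) (pow t d))" "primitive (drop M (pow t d))"
    "4 \<le> d \<Longrightarrow> primitive (drop (2 * M) (pow t d))"
proof -
  have l: "length (pow t d) = 3 * M" using len by simp
  have c: "\<not> 3 dvd 2 * d" using d(1) by presburger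
  show "primitive (take (2 * M) (pow t d))"
    by (rule primitive_factor_pow[OF t, of "2 * M" 0 d _ "2 * d"]) (use l len c d in simp_all)
  show "primitive (drop M (pow t d))"
    \<comment> \<open>Only 2M letters remain, so taking \<open>3 * M\<close> of them takes the
      entire suffix.\<close>
    by (rule primitive_factor_pow[OF t, of "3 * M" M d _ "2 * d"]) (use l len c d in simp_all)
  show "primitive (drop (2 * M) (pow t d))" if "4 \<le> d"
    by (rule primitive_factor_pow[OF t, of "3 * M" "2 * M" d _ d]) (use that l len d in simp_all)
qed

text \<open>The cuts at M and 2M fall between copies of \<open>t\<close>, so both factors are powers
  of \<open>t\<close> with an even exponent.\<close>

lemma not_primitive_thirds_pow:
  assumes "t \<noteq> []" "3 * M = d * length t" "3 dvd d"
  shows "\<not> primitive (take (2 * M) (pow t d))" "\<not> primitive (drop M (pow t d))"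
proof -
  obtain e where e: "d = 3 * e" using assms(3) by blast
  then have M: "M = e * length t" using assms(2) by simp
  have "pow t d = pow t e @ pow t (2 * e)" using pow_add[of e "2 * e" t] by (simp add: e)
  then have "drop M (pow t d) = pow t (2 * e)" by (simp add: M)
  moreover have "pow t d = pow t (2 * e) @ pow t e" using pow_add[of "2 * e" e t] by (simp add: e)
  then have "take (2 * M) (pow t d) = pow t (2 * e)" by (simp add: M)
  moreover have "2 * e \<noteq> 1" by presburger
  ultimately show "\<not> primitive (take (2 * M) (pow t d))" "\<not> primitive (drop M (pow t d))"
    using not_primitive_pow by metis+
qed

subsection \<open>Counting\<close>

definition power_words :: "'a set \<Rightarrow> nat \<Rightarrow> nat set \<Rightarrow> 'a list set" where
  "power_words A N D =
    {w. \<exists>t d. w = pow t d \<and> d \<in> D \<and> t \<in> lists A \<and> primitive t \<and> d * length t = N}"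

lemma words_eq: "{w \<in> lists A. length w = k} = {w. set w \<subseteq> A \<and> length w = k}"
  by auto

lemma finite_words: "finite A \<Longrightarrow> finite {w \<in> lists A. length w = k}"
  unfolding words_eq by (rule finite_lists_length_eq)

lemma card_words: "finite A \<Longrightarrow> card {w \<in> lists A. length w = k} = card A ^ k"
  unfolding words_eq by (rule card_lists_length_eq)

lemma finite_primitive_words: "finite A \<Longrightarrow> finite (primitive_words A k)"
  by (rule finite_subset[OF _ finite_words[of A k]]) (auto simp: primitive_words_def)

text \<open>Periods only compare letters for equality. This is what makes the number of primitive
  words depend on the size of the alphabet alone.\<close>

lemma primitive_map_inj:
  assumes "inj_on h (set u)"
  shows "primitive (map h u) \<longleftrightarrow> primitive u"
proof -
  have "periodic ((!) (map h u)) (length u) g \<longleftrightarrow> periodic ((!) u) (length u) g" for g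
  proof -
    have "map h u ! i = map h u ! (i mod g) \<longleftrightarrow> u ! i = u ! (i mod g)" if i: "i < length u" for i
    proof -
      have j: "i mod g < length u" using i by (meson le_less_trans mod_less_eq_dividend)
      then show ?thesis using i assms by (simp add: inj_on_eq_iff)
    qed
    then show ?thesis by (simp add: periodic_def)
  qed
  then show ?thesis by (simp add: primitive_iff_periodic)
qed

lemma card_primitive_words:
  assumes "finite A"
  shows "card (primitive_words A k) = num_primitive (card A) k"
proof -
  obtain h where h: "bij_betw h {..<card A} A"
    using ex_bij_betw_nat_finite[OF assms] by (auto simp: atLeast0LessThan)
  have inj: "inj_on (map h) (lists {..<card A})" and img: "map h ` lists {..<card A} = lists A"
    using bij_lists[OF h] by (auto simp: bij_betw_def)
  have iff: "primitive (map h u) \<longleftrightarrow> primitive u" if "u \<in> lists {..<card A}" for u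
    by (rule primitive_map_inj) (use that h in \<open>auto simp: bij_betw_def intro: inj_on_subset\<close>)
  have "primitive_words A k = {w \<in> map h ` lists {..<card A}. length w = k \<and> primitive w}"
    by (simp only: primitive_words_def img)
  also have "\<dots> = map h ` primitive_words {..<card A} k"
  proof (intro equalityI subsetI)
    fix w assume "w \<in> {w \<in> map h ` lists {..<card A}. length w = k \<and> primitive w}"
    then obtain u where u: "w = map h u" "u \<in> lists {..<card A}" "length w = k" "primitive w"
      by blast
    then have "u \<in> primitive_words {..<card A} k"
      using iff[of u] unfolding primitive_words_def by simp
    then show "w \<in> map h ` primitive_words {..<card A} k" using u(1) by blast
  next
    fix w assume "w \<in> map h ` primitive_words {..<card A} k"
    then obtain u where u: "w = map h u" "u \<in> lists {..<card A}" "length u = k" "primitive u"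
      unfolding primitive_words_def by blast
    then show "w \<in> {w \<in> map h ` lists {..<card A}. length w = k \<and> primitive w}"
      using iff[of u] by (metis (mono_tags, lifting) image_eqI length_map mem_Collect_eq)
  qed
  finally have "primitive_words A k = map h ` primitive_words {..<card A} k" .
  moreover have "inj_on (map h) (primitive_words {..<card A} k)"
    by (rule inj_on_subset[OF inj]) (auto simp: primitive_words_def)
  ultimately show ?thesis by (simp add: card_image num_primitive_def)
qed

text \<open>Uniqueness of primitive roots makes the classes for different exponents disjoint and the
  map from \<open>t\<close> to \<open>pow t d\<close> injective on primitive words.\<close>

lemma card_power_words:
  assumes "finite A" "finite D" "0 < N" "\<And>d. d \<in> D \<Longrightarrow> d dvd N"
  shows "finite (power_words A N D)"
    "card (power_words A N D) = (\<Sum>d\<in>D. num_primitive (card A) (N div d))"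
proof -
  let ?P = "\<lambda>d. (\<lambda>t. pow t d) ` primitive_words A (N div d)"
  have pos: "0 < d" if "d \<in> D" for d
    using assms(3,4) that by (metis dvd_0_left_iff gr0I less_irrefl)
  have eq: "power_words A N D = (\<Union>d\<in>D. ?P d)"
  proof (rule set_eqI)
    fix w
    have "d * length t = N \<longleftrightarrow> length t = N div d" if "d \<in> D" for d and t :: "'a list"
      using pos[OF that] assms(4)[OF that] by auto
    then show "w \<in> power_words A N D \<longleftrightarrow> w \<in> (\<Union>d\<in>D. ?P d)"
      unfolding power_words_def primitive_words_def by blast
  qed
  show "finite (power_words A N D)"
    unfolding eq using assms(1,2) finite_primitive_words by blast
  have "card (\<Union>d\<in>D. ?P d) = (\<Sum>d\<in>D. card (?P d))"
  proof (rule card_UN_disjoint)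
    show "\<forall>d\<in>D. \<forall>e\<in>D. d \<noteq> e \<longrightarrow> ?P d \<inter> ?P e = {}"
    proof (intro ballI impI equals0I)
      fix d e w assume de: "d \<in> D" "e \<in> D" "d \<noteq> e" "w \<in> ?P d \<inter> ?P e"
      then obtain s t where "w = pow s d" "w = pow t e" "primitive s" "primitive t"
        unfolding primitive_words_def by blast
      then show False using primitive_root_unique[of s t d e] pos de by simp
    qed
  qed (use assms finite_primitive_words in auto)
  also have "\<dots> = (\<Sum>d\<in>D. num_primitive (card A) (N div d))"
  proof (rule sum.cong)
    fix d assume "d \<in> D"
    then have "inj_on (\<lambda>t. pow t d) (primitive_words A (N div d))"
      using primitive_root_unique pos unfolding primitive_words_def inj_on_def by blast
    then show "card (?P d) = num_primitive (card A) (N div d)"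
      by (simp add: card_image card_primitive_words assms(1))
  qed simp
  finally show "card (power_words A N D) = (\<Sum>d\<in>D. num_primitive (card A) (N div d))"
    unfolding eq .
qed

section \<open>Sorting the pairs by the exponent of pq\<close>

lemma pow_2: "pow t 2 = t @ t"
  by (simp add: numeral_2_eq_2)

lemma set_pow: "0 < d \<Longrightarrow> set (pow t d) = set t"
  by (cases d) auto

lemma lists_pow_iff: "0 < d \<Longrightarrow> pow t d \<in> lists A \<longleftrightarrow> t \<in> lists A"
  by (simp only: in_lists_conv_set set_pow)

lemma nonprimitive_power_words:
  assumes "w \<in> lists A" "\<not> primitive w" "length w = N" "0 < N"
  obtains t d where "w = pow t d" "2 \<le> d" "t \<in> lists A" "primitive t" "d * length t = N"
proof -
  have "w \<noteq> []" using assms(3,4) by auto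
  then obtain t d where t: "0 < d" "primitive t" "w = pow t d"
    using primitive_root_exists by blast
  have "d \<noteq> 1" using assms(2) t by auto
  then have "2 \<le> d" using t(1) by simp
  moreover have "t \<in> lists A" using assms(1) unfolding t(3) lists_pow_iff[OF t(1)] .
  moreover have "d * length t = N" using assms(3) t(3) by simp
  ultimately show thesis using that t by blast
qed

lemma dvd_third:
  assumes "d dvd 3 * M" "\<not> 3 dvd d"
  shows "d dvd (M::nat)"
proof -
  obtain k where k: "3 * M = d * k" using assms(1) by blast
  then have "3 dvd k"
    using coprime_3[OF assms(2)] by (metis coprime_dvd_mult_right_iff dvd_triv_left)
  then obtain j where "k = 3 * j" by blast
  then have "M = d * j" using k by simp
  then show ?thesis by simp
qed

text \<open>These are the words xu with u primitive that must be discarded when counting square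
  roots t = xu. The suffix is two thirds of the power: it is a proper power if 3 divides the
  exponent and is primitive otherwise.\<close>

lemma nonprimitive_primitive_suffix_eq:
  assumes "0 < M"
  shows "{t \<in> lists A. length t = 3 * M \<and> \<not> primitive t \<and> primitive (drop M t)} =
    power_words A (3 * M) {e. e dvd M \<and> e mod 3 \<noteq> 0 \<and> 2 \<le> e}" (is "?L = ?R")
proof (intro equalityI subsetI)
  fix w assume w: "w \<in> ?L"
  have "0 < 3 * M" using assms by simp
  then obtain t d where t: "w = pow t d" "2 \<le> d" "t \<in> lists A" "primitive t" "d * length t = 3 * M"
    using nonprimitive_power_words[of w A "3 * M"] w by blast
  then have "\<not> 3 dvd d"
    using not_primitive_thirds_pow(2)[of t M d] w by (auto simp: primitive_def)
  moreover from this have "d dvd M" using dvd_third t(5) by (metis dvd_triv_left)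
  ultimately have "d \<in> {e. e dvd M \<and> e mod 3 \<noteq> 0 \<and> 2 \<le> e}"
    using t(2) by (simp add: dvd_eq_mod_eq_0)
  then show "w \<in> ?R" using t unfolding power_words_def by blast
next
  fix w assume "w \<in> ?R"
  then obtain t d where t: "w = pow t d" "2 \<le> d" "\<not> 3 dvd d" "t \<in> lists A" "primitive t"
    "d * length t = 3 * M"
    unfolding power_words_def by (auto simp: dvd_eq_mod_eq_0)
  then show "w \<in> ?L"
    using primitive_thirds_pow(2)[of t M d] not_primitive_pow[of d t] lists_pow_iff[of d t A]
    by simp
qed

text \<open>The case of exponent 2: with t = xu and |x| = l/2, the word xuxu splits into p = xux and
  q = u, and the last condition says that q is primitive. The length equation leaves the set empty
  for odd \<open>l\<close>.\<close>

definition square_words :: "'a set \<Rightarrow> nat \<Rightarrow> 'a list set" where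
  "square_words A l = {w. \<exists>t. w = t @ t \<and> t \<in> lists A \<and> primitive t \<and>
     2 * length t = 3 * l \<and> primitive (drop (l div 2) t)}"

text \<open>The lengths are fixed, so a pair is determined by pq. The exponent d of the primitive
  root of pq is not a multiple of 3, since p is primitive; so d = 2 or d \<ge> 4.\<close>

lemma epsilon_eq_card:
  assumes l: "0 < l"
  shows "epsilon A l = card (power_words A (3 * l) (Lambda l) \<union> square_words A l)"
proof -
  let ?E = "{(p, q). p \<in> lists A \<and> q \<in> lists A \<and> primitive p \<and> primitive q \<and>
     length p = 2 * length q \<and> 2 * length q = 2 * l \<and> \<not> primitive (p @ q)}"
  let ?S = "{w \<in> lists A. length w = 3 * l \<and> \<not> primitive w \<and>
     primitive (take (2 * l) w) \<and> primitive (drop (2 * l) w)}"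
  have "bij_betw (\<lambda>(p, q). p @ q) ?E ?S"
  proof (rule bij_betw_byWitness[where f' = "\<lambda>w. (take (2 * l) w, drop (2 * l) w)"])
    show "(\<lambda>w. (take (2 * l) w, drop (2 * l) w)) ` ?S \<subseteq> ?E"
      by (auto dest: in_set_takeD in_set_dropD)
  qed auto
  then have "epsilon A l = card ?S"
    unfolding epsilon_def by (rule bij_betw_same_card)
  also have "?S = power_words A (3 * l) (Lambda l) \<union> square_words A l" (is "_ = ?R")
  proof (intro equalityI subsetI)
    fix w assume w: "w \<in> ?S"
    have "0 < 3 * l" using l by simp
    then obtain t d where t: "w = pow t d" "2 \<le> d" "t \<in> lists A" "primitive t" "d * length t = 3 * l"
      using nonprimitive_power_words[of w A "3 * l"] w by blast
    then have nd: "\<not> 3 dvd d"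
      using not_primitive_thirds_pow(1)[of t l d] w by (auto simp: primitive_def)
    show "w \<in> ?R"
    proof (cases "d = 2")
      case True
      then have tt: "w = t @ t" using t(1) by (simp add: pow_2)
      have len: "2 * length t = 3 * l" using t True by simp
      \<comment> \<open>Since |t| = 3l/2, the cut at 2l lies l/2 letters into the second copy of
        \<open>t\<close>.\<close>
      then have "2 * l - length t = l div 2" "length t \<le> 2 * l" by presburger+
      then have "drop (2 * l) w = drop (l div 2) t" by (simp add: tt)
      then show ?thesis using w t(3,4) tt len unfolding square_words_def by auto
    next
      case False
      then have "4 \<le> d" using nd t(2) by presburger
      moreover have "d dvd l" using dvd_third t(5) nd by (metis dvd_triv_left)
      ultimately have "d \<in> Lambda l" using nd by (simp add: Lambda_def dvd_eq_mod_eq_0)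
      then show ?thesis using t unfolding power_words_def by blast
    qed
  next
    fix w assume "w \<in> ?R"
    then show "w \<in> ?S"
    proof
      assume "w \<in> power_words A (3 * l) (Lambda l)"
      then obtain t d where t: "w = pow t d" "4 \<le> d" "\<not> 3 dvd d" "t \<in> lists A" "primitive t"
        "d * length t = 3 * l"
        unfolding power_words_def Lambda_def by (auto simp: dvd_eq_mod_eq_0)
      then show ?thesis
        using primitive_thirds_pow[of t l d] not_primitive_pow[of d t] lists_pow_iff[of d t A]
        by simp
    next
      assume "w \<in> square_words A l"
      then obtain t where t: "w = t @ t" "t \<in> lists A" "primitive t" "2 * length t = 3 * l"
        "primitive (drop (l div 2) t)"
        unfolding square_words_def by blast
      define m where "m = l div 2"
      have lm: "l = 2 * m" "length t = 3 * m" using t(4) m_def by presburger+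
      have "take (2 * l) w = take m t @ drop m t @ take m t"
        by (simp add: t(1) lm)
      moreover have "drop (2 * l) w = drop m t" by (simp add: t(1) lm)
      moreover have "primitive (take m t @ drop m t @ take m t)"
        by (rule primitive_conj_double) (use t(5) lm(2) in \<open>simp_all add: m_def[symmetric]\<close>)
      moreover have "\<not> primitive (t @ t)"
        using not_primitive_pow[of 2 t] by (simp add: pow_2)
      moreover have "drop (l div 2) t = drop m t" by (simp only: m_def)
      moreover have "t @ t \<in> lists A" "length (t @ t) = 3 * l" using t(2,4) by simp_all
      ultimately show ?thesis using t(1,5) by simp
    qed
  qed
  finally show ?thesis .
qed

lemma square_words_disjoint: "power_words A N (Lambda l) \<inter> square_words A l = {}"
proof -
  have False if "pow t d = s @ s" "4 \<le> d" "primitive t" "primitive s" for t s :: "'a list" and d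
  proof -
    have "pow t d = pow s 2" using that(1) by (simp add: pow_2)
    then show False using primitive_root_unique[of t s d 2] that by simp
  qed
  then show ?thesis unfolding power_words_def square_words_def Lambda_def by blast
qed

text \<open>Among the words xu with |x| = m and u primitive of length 2m, those with xu primitive
  give the squares and the others give the sum. The identity is additive to avoid subtraction on
  naturals.\<close>

lemma card_square_words:
  assumes A: "finite A" and m: "0 < m"
  shows "card (square_words A (2 * m)) +
    (\<Sum>e | e dvd m \<and> e mod 3 \<noteq> 0 \<and> 2 \<le> e. num_primitive (card A) (3 * m div e)) =
    card A ^ m * num_primitive (card A) (2 * m)"
proof -
  let ?X = "{t \<in> lists A. length t = 3 * m \<and> primitive t \<and> primitive (drop m t)}"
  let ?Y = "{t \<in> lists A. length t = 3 * m \<and> \<not> primitive t \<and> primitive (drop m t)}"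
  let ?Z = "{t \<in> lists A. length t = 3 * m \<and> primitive (drop m t)}"
  have "square_words A (2 * m) = (\<lambda>t. t @ t) ` ?X"
    unfolding square_words_def by auto
  moreover have "inj_on (\<lambda>t. t @ t) ?X" by (auto simp: inj_on_def)
  ultimately have "card (square_words A (2 * m)) = card ?X" by (simp add: card_image)
  moreover have "card ?Y =
    (\<Sum>e | e dvd m \<and> e mod 3 \<noteq> 0 \<and> 2 \<le> e. num_primitive (card A) (3 * m div e))"
    unfolding nonprimitive_primitive_suffix_eq[OF m]
    by (rule card_power_words) (use A m in \<open>auto intro: finite_subset[OF _ finite_divisors_nat[OF m]]\<close>)
  moreover have "card ?X + card ?Y = card ?Z"
  proof -
    have "finite ?Z" by (rule finite_subset[OF _ finite_words[OF A, of "3 * m"]]) auto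
    moreover have "?Z = ?X \<union> ?Y" by blast
    moreover have "?X \<inter> ?Y = {}" by blast
    ultimately show ?thesis by (simp only: card_Un_disjoint finite_Un)
  qed
  moreover have "card ?Z = card ({x \<in> lists A. length x = m} \<times> primitive_words A (2 * m))"
    by (rule bij_betw_same_card[of "\<lambda>t. (take m t, drop m t)"],
        rule bij_betw_byWitness[where f' = "\<lambda>(x, u). x @ u"])
      (auto simp: primitive_words_def dest: in_set_takeD in_set_dropD)
  ultimately show ?thesis
    using A by (simp add: card_cartesian_product card_words card_primitive_words)
qed

theorem theorem3p7:
  fixes A :: "'a set" and n l :: nat
  assumes "finite A" and "card A = n" and "n \<ge> 2" and "l > 0"
  shows "epsilon A l =
    (if even l
     then n ^ (l div 2) * num_primitive n l + (\<Sum>d\<in>Lambda_odd l. num_primitive n (3 * l div d))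
     else (\<Sum>d\<in>Lambda l. num_primitive n (3 * l div d)))"
proof -
  have finL: "finite (Lambda l)"
    by (rule finite_subset[OF _ finite_divisors_nat[OF assms(4)]]) (auto simp: Lambda_def)
  have dvd: "d dvd 3 * l" if "d \<in> Lambda l" for d using that by (simp add: Lambda_def)
  have P: "finite (power_words A (3 * l) (Lambda l))" "card (power_words A (3 * l) (Lambda l)) =
      (\<Sum>d\<in>Lambda l. num_primitive n (3 * l div d))"
    using card_power_words[OF assms(1) finL _ dvd] assms(2,4) by auto
  have "finite (square_words A l)"
    by (rule finite_subset[OF _ finite_words[OF assms(1), of "3 * l"]])
      (auto simp: square_words_def)
  then have eps: "epsilon A l =
      (\<Sum>d\<in>Lambda l. num_primitive n (3 * l div d)) + card (square_words A l)"
    using epsilon_eq_card[OF assms(4), of A] P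
      card_Un_disjoint[OF P(1) _ square_words_disjoint[of A "3 * l" l]] by simp
  show ?thesis
  proof (cases "even l")
    case False
    \<comment> \<open>A square would need 2|t| = 3l, which is odd.\<close>
    then have "square_words A l = {}" unfolding square_words_def by (auto, presburger)
    then show ?thesis using eps False by simp
  next
    case True
    then obtain m where m: "l = 2 * m" by blast
    let ?G = "{e. e dvd m \<and> e mod 3 \<noteq> 0 \<and> 2 \<le> e}"
    \<comment> \<open>Doubling matches the exponents e \<ge> 2 of nonprimitive xu with the even
      elements of \<open>Lambda l\<close>: the bound becomes 2e \<ge> 4, and divisibility by 3 is
      unaffected.\<close>
    have bij: "bij_betw (\<lambda>e. 2 * e) ?G (Lambda l - Lambda_odd l)"
    proof (rule bij_betw_byWitness[where f' = "\<lambda>d. d div 2"])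
      show "(\<lambda>e. 2 * e) ` ?G \<subseteq> Lambda l - Lambda_odd l"
      proof
        fix d assume "d \<in> (\<lambda>e. 2 * e) ` ?G"
        then obtain e where e: "d = 2 * e" "e dvd m" "e mod 3 \<noteq> 0" "2 \<le> e" by blast
        have "d mod 3 \<noteq> 0" "4 \<le> d" "even d" using e(1,3,4) by presburger+
        then show "d \<in> Lambda l - Lambda_odd l"
          using e m by (simp add: Lambda_def Lambda_odd_def)
      qed
      show "(\<lambda>d. d div 2) ` (Lambda l - Lambda_odd l) \<subseteq> ?G"
      proof
        fix e assume "e \<in> (\<lambda>d. d div 2) ` (Lambda l - Lambda_odd l)"
        then obtain d where d: "e = d div 2" "d dvd l" "d mod 3 \<noteq> 0" "4 \<le> d" "even d"
          by (auto simp: Lambda_def Lambda_odd_def)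
        have "d = 2 * e" "e mod 3 \<noteq> 0" "2 \<le> e" using d(1,3,4,5) by presburger+
        then show "e \<in> ?G" using d(2) m by simp
      qed
    qed (auto simp: Lambda_def Lambda_odd_def)
    have "(\<Sum>e\<in>?G. num_primitive n (3 * l div (2 * e))) =
        (\<Sum>d\<in>Lambda l - Lambda_odd l. num_primitive n (3 * l div d))"
      by (rule sum.reindex_bij_betw[OF bij])
    moreover have "3 * l div (2 * e) = 3 * m div e" for e
      using div_mult_mult1[of 2 "3 * m" e] m by (simp add: mult.left_commute)
    ultimately have G: "(\<Sum>e\<in>?G. num_primitive n (3 * m div e)) =
        (\<Sum>d\<in>Lambda l - Lambda_odd l. num_primitive n (3 * l div d))" by simp
    have "(\<Sum>d\<in>Lambda l. num_primitive n (3 * l div d)) =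
        (\<Sum>d\<in>Lambda l - Lambda_odd l. num_primitive n (3 * l div d)) +
        (\<Sum>d\<in>Lambda_odd l. num_primitive n (3 * l div d))"
      by (rule sum.subset_diff) (auto simp: Lambda_odd_def finL)
    moreover have "card (square_words A l) + (\<Sum>e\<in>?G. num_primitive n (3 * m div e)) =
        n ^ (l div 2) * num_primitive n l"
      using card_square_words[OF assms(1), of m] m assms(2,4) by simp
    \<comment> \<open>The sum over \<open>?G\<close> equals the even part of the sum over
      \<open>Lambda l\<close>, so it cancels and leaves the odd part.\<close>
    ultimately show ?thesis using True eps G by simp
  qed
qed

end
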